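(* Let $\varphi$ be a strongly convex function, and let $\Psi:[0,\infty)\to[0,\infty)$ be a strictly increasing, convex, unbounded function such that $$\mathcal H_\Psi\subset\operatorname{Mult}(\mathcal H_{\varphi\circ\log}).$$ Then there exists a sequence $\Lambda\subset\mathbb D$ which is not a Carleson sequence and which is a free interpolating sequence for $\mathcal H_{\varphi\circ\log}$.
   Context: $\mathbb D$ is the open unit disk, $\mathbb T=\partial\mathbb D$ with normalized Lebesgue measure $m$, $\operatorname{Hol}(\mathbb D)$ is the space of holomorphic functions on $\mathbb D$, and $N^+$ is the Smirnov class on $\mathbb D$; functions in $N^+$ have non-tangential boundary values a.e. on $\mathbb T$, denoted by the same letter. A function $\varphi:\mathbb R\to[0,\infty)$ is strongly convex if it is convex, nondecreasing and $\lim_{t\to\infty}\varphi(t)/t=\infty$; one sets $\varphi(-\infty)=0$. For a nondecreasing $\Phi:[0,\infty)\to[0,\infty)$, the Hardy-Orlicz class is $\mathcal H_\Phi=\{f\in N^+:\int_{\mathbb T}\Phi(|f|)\,dm<\infty\}$. For $X\subset\operatorname{Hol}(\mathbb D)$, $\operatorname{Mult}(X)=\{g\in\operatorname{Hol}(\mathbb D): gf\in X \text{ for all } f\in X\}$. A sequence $\Lambda=\{\lambda_n\}_n$ of distinct points of $\mathbb D$ is a Carleson sequence if it satisfies the Blaschke condition $\sum_n(1-|\lambda_n|^2)<\infty$ and $\inf_{\lambda\in\Lambda}|B_{\Lambda\setminus\{\lambda\}}(\lambda)|>0$, where $B_E=\prod_{\lambda\in E}b_\lambda$ and $b_\lambda(z)=\frac{|\lambda|}{\lambda}\frac{\lambda-z}{1-\overline\lambda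 z}$ (with $b_0(z)=z$). A sequence $\Lambda=\{\lambda_n\}_n$ of distinct points of $\mathbb D$ is a free interpolating sequence for $X\subset\operatorname{Hol}(\mathbb D)$ if for every $f\in X$ and every complex sequence $(b_n)_n$ with $|b_n|\le|f(\lambda_n)|$ for all $n$, there exists $g\in X$ with $g(\lambda_n)=b_n$ for all $n$. *)

theory Defs
  imports "HOL-Complex_Analysis.Complex_Analysis"
begin

abbreviation unit_disk :: "complex set"
  where "unit_disk \<equiv> ball 0 1"

text \<open>
  Functions on the disk are total functions of type \<^typ>\<open>complex \<Rightarrow> complex\<close>; every notion
  below depends only on their values on the open unit disk.
\<close>

definition Hol_disk :: "(complex \<Rightarrow> complex) set"
  where "Hol_disk = {f. f holomorphic_on unit_disk}"

text \<open>
  Normalized Lebesgue measure on the unit circle, as a Borel probability measure on the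
  complex plane: the image of the uniform distribution on an interval of length \<open>2\<pi>\<close>
  under \<open>t \<mapsto> exp (i t)\<close>.
\<close>

definition circle_measure :: "complex measure"
  where "circle_measure = distr (uniform_measure lborel {0..2 * pi}) borel cis"

definition stolz_region :: "real \<Rightarrow> complex \<Rightarrow> complex set"
  where "stolz_region \<alpha> \<zeta> = {z \<in> unit_disk. norm (z - \<zeta>) < \<alpha> * (1 - norm z)}"

definition has_nontangential_limit :: "(complex \<Rightarrow> complex) \<Rightarrow> complex \<Rightarrow> complex \<Rightarrow> bool"
  where "has_nontangential_limit f \<zeta> L \<longleftrightarrow>
    (\<forall>\<alpha>>1. (f \<longlongrightarrow> L) (at \<zeta> within stolz_region \<alpha> \<zeta>))"

text \<open>
  Unspecified (but the same constant) at points where no non-tangential limit exists; for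
  functions of the Nevanlinna class these points form a null set of the circle.
\<close>

definition boundary_value :: "(complex \<Rightarrow> complex) \<Rightarrow> complex \<Rightarrow> complex"
  where "boundary_value f \<zeta> = (THE L. has_nontangential_limit f \<zeta> L)"

definition log_plus :: "real \<Rightarrow> real"
  where "log_plus x = ln (max 1 x)"

definition log_plus_mean :: "(complex \<Rightarrow> complex) \<Rightarrow> real \<Rightarrow> ennreal"
  where "log_plus_mean f r =
    (\<integral>\<^sup>+\<zeta>. ennreal (log_plus (norm (f (of_real r * \<zeta>)))) \<partial>circle_measure)"

definition Nevanlinna_class :: "(complex \<Rightarrow> complex) set"
  where "Nevanlinna_class = {f \<in> Hol_disk. (SUP r\<in>{0..<1}. log_plus_mean f r) < \<infinity>}"

definition Smirnov_class :: "(complex \<Rightarrow> complex) set"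
  where "Smirnov_class = {f \<in> Nevanlinna_class.
    (log_plus_mean f \<longlongrightarrow>
      (\<integral>\<^sup>+\<zeta>. ennreal (log_plus (norm (boundary_value f \<zeta>))) \<partial>circle_measure)) (at_left 1)}"

text \<open>Only the values of \<open>\<Phi>\<close> on the nonnegative reals matter.\<close>

definition Hardy_Orlicz :: "(real \<Rightarrow> real) \<Rightarrow> (complex \<Rightarrow> complex) set"
  where "Hardy_Orlicz \<Phi> = {f \<in> Smirnov_class.
    (\<integral>\<^sup>+\<zeta>. ennreal (\<Phi> (norm (boundary_value f \<zeta>))) \<partial>circle_measure) < \<infinity>}"

definition Mult :: "(complex \<Rightarrow> complex) set \<Rightarrow> (complex \<Rightarrow> complex) set"
  where "Mult X = {g \<in> Hol_disk. \<forall>f\<in>X. (\<lambda>z. g z * f z) \<in> X}"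

definition strongly_convex :: "(real \<Rightarrow> real) \<Rightarrow> bool"
  where "strongly_convex \<phi> \<longleftrightarrow>
    (\<forall>t. 0 \<le> \<phi> t) \<and> convex_on UNIV \<phi> \<and> mono \<phi> \<and> filterlim (\<lambda>t. \<phi> t / t) at_top at_top"

text \<open>\<open>\<phi> \<circ> log\<close> on the nonnegative reals, with the convention \<open>\<phi> (-\<infinity>) = 0\<close>.\<close>

definition comp_log :: "(real \<Rightarrow> real) \<Rightarrow> real \<Rightarrow> real"
  where "comp_log \<phi> x = (if x > 0 then \<phi> (ln x) else 0)"

definition blaschke_factor :: "complex \<Rightarrow> complex \<Rightarrow> complex"
  where "blaschke_factor a z =
    (if a = 0 then z else (of_real (norm a) / a) * ((a - z) / (1 - cnj a * z)))"

definition blaschke_product :: "(nat \<Rightarrow> complex) \<Rightarrow> nat set \<Rightarrow> complex \<Rightarrow> complex"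
  where "blaschke_product \<Lambda> I z = (\<Prod>n. if n \<in> I then blaschke_factor (\<Lambda> n) z else 1)"

definition disk_sequence :: "(nat \<Rightarrow> complex) \<Rightarrow> bool"
  where "disk_sequence \<Lambda> \<longleftrightarrow> inj \<Lambda> \<and> range \<Lambda> \<subseteq> unit_disk"

definition Carleson_sequence :: "(nat \<Rightarrow> complex) \<Rightarrow> bool"
  where "Carleson_sequence \<Lambda> \<longleftrightarrow> disk_sequence \<Lambda> \<and>
    summable (\<lambda>n. 1 - (norm (\<Lambda> n))\<^sup>2) \<and>
    (INF k. norm (blaschke_product \<Lambda> (- {k}) (\<Lambda> k))) > 0"

text \<open>
  Sequences are infinite. Since a finite subset of the disk is always a Carleson sequence,
  nothing is lost when asserting the existence of a non-Carleson sequence.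
\<close>

definition free_interpolating :: "(complex \<Rightarrow> complex) set \<Rightarrow> (nat \<Rightarrow> complex) \<Rightarrow> bool"
  where "free_interpolating X \<Lambda> \<longleftrightarrow> disk_sequence \<Lambda> \<and>
    (\<forall>f\<in>X. \<forall>b :: nat \<Rightarrow> complex. (\<forall>n. norm (b n) \<le> norm (f (\<Lambda> n))) \<longrightarrow>
      (\<exists>g\<in>X. \<forall>n. g (\<Lambda> n) = b n))"

end

theory Submission
  imports Defs "HOL-Probability.Probability"
begin

text \<open>
  If \<open>\<Lambda>\<close> interpolates every bounded sequence by a function \<open>h\<close> of \<open>\<H>\<^sub>\<Psi>\<close>, then it is free
  interpolating for every space \<open>X\<close> that \<open>\<H>\<^sub>\<Psi>\<close> multiplies: given \<open>f\<close> and \<open>b\<close>, take \<open>g = h f\<close> with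
  \<open>h(\<lambda>\<^sub>n) = b\<^sub>n / f(\<lambda>\<^sub>n)\<close>. Such a \<open>\<Lambda>\<close> need not be Carleson: let it consist of points
  \<open>\<lambda>\<^sub>j = 1 - 1/p\<^sub>j\<close> coming in pairs whose pseudohyperbolic distance tends to 0. Interpolate in
  Newton form, \<open>h = \<Sum>\<^sub>j a\<^sub>j v\<^sub>j\<close> with \<open>v\<^sub>j\<close> vanishing at the earlier points. As long as the \<open>p\<^sub>j\<close> keep
  a prescribed relative separation, the \<open>a\<^sub>j\<close> have bounds depending only on \<open>j\<close>. So if the
  pairs tend to 1 fast enough, \<open>h\<close> grows towards 1 as slowly as we like, while it is continuous on
  the rest of the closed disk; in particular it lies in \<open>\<H>\<^sub>\<Psi>\<close>.
\<close>

subsection \<open>Membership in Hardy-Orlicz classes\<close>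

lemma prob_space_circle_measure: "prob_space circle_measure"
proof -
  interpret prob_space "uniform_measure lborel {0..2*pi::real}"
    by (rule prob_space_uniform_measure) auto
  have [measurable]: "cis \<in> borel_measurable borel"
    by (simp add: borel_measurable_continuous_onI continuous_on_cis)
  show ?thesis
    unfolding circle_measure_def
    by (rule prob_space_distr) measurable
qed

lemma sets_circle_measure [simp, measurable_cong]: "sets circle_measure = sets borel"
  by (simp add: circle_measure_def)

lemma space_circle_measure [simp]: "space circle_measure = UNIV"
  by (simp add: circle_measure_def)

text \<open>The parametrization \<open>cis\<close> hits 1 only countably often. This makes the
  single possible boundary discontinuity of the interpolating functions negligible.\<close>

lemma AE_circle_measure: "AE \<zeta> in circle_measure. \<zeta> \<in> sphere 0 1 - {1}"
proof -
  have [measurable]: "cis \<in> borel_measurable borel"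
    by (simp add: borel_measurable_continuous_onI continuous_on_cis)
  have "{t. cis t = 1} \<subseteq> range (\<lambda>n::int. of_int n * 2 * pi)"
    by (auto simp: complex_eq_iff cos_one_2pi_int)
  hence "countable {t. cis t = 1}"
    by (rule countable_subset) simp
  hence "AE t in lborel. cis t \<noteq> 1"
    by (intro AE_I[where N = "{t. cis t = 1}"]) (auto simp: emeasure_lborel_countable)
  hence "AE t in uniform_measure lborel {0..2*pi}. cis t \<in> sphere 0 1 - {1}"
    by (intro AE_uniform_measureI) auto
  thus ?thesis
    unfolding circle_measure_def by (subst AE_distr_iff) auto
qed

text \<open>Continuity from above along balls shrinking to the null set \<open>{1}\<close>; no rate
  is extracted. The form \<open>2 / R\<close> matches the factor 2 in
  \<open>norm_one_minus_circle_le\<close>.\<close>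

lemma circle_measure_cball_small:
  assumes "\<epsilon> > 0"
  shows "\<exists>K>0. \<forall>R\<ge>K. measure circle_measure (cball 1 (2 / R)) \<le> \<epsilon>"
proof -
  interpret prob_space circle_measure by (rule prob_space_circle_measure)
  define C where "C = (\<lambda>n. cball (1::complex) (inverse (real (Suc n))))"
  have C: "range C \<subseteq> sets circle_measure" "decseq C"
    by (auto simp: C_def decseq_def intro!: subset_cball le_imp_inverse_le)
  have "(\<Inter>n. C n) = {1}"
  proof -
    have "x = 1" if "\<And>n. x \<in> C n" for x
    proof (rule ccontr)
      assume "x \<noteq> 1"
      then obtain n where "inverse (real (Suc n)) < dist 1 x"
        using reals_Archimedean[of "dist 1 x"] by auto
      with that[of n] show False by (simp add: C_def)
    qed
    thus ?thesis by (auto simp: C_def)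
  qed
  moreover have "measure circle_measure {1} = 0"
    using AE_circle_measure by (intro prob_eq_0[THEN iffD2]) auto
  ultimately have "(\<lambda>n. measure circle_measure (C n)) \<longlonglongrightarrow> 0"
    using finite_Lim_measure_decseq[OF C] by simp
  hence "\<forall>\<^sub>F n in sequentially. measure circle_measure (C n) < \<epsilon>"
    using assms by (rule order_tendstoD)
  then obtain n where n: "measure circle_measure (C n) < \<epsilon>"
    by (auto simp: eventually_sequentially)
  show ?thesis
  proof (intro exI[of _ "2 * real (Suc n)"] conjI allI impI)
    fix R assume R: "2 * real (Suc n) \<le> R"
    have "2 / R \<le> inverse (real (Suc n))"
    proof -
      have "2 / R \<le> 2 / (2 * real (Suc n))"
        using R by (intro divide_left_mono) auto
      also have "\<dots> = inverse (real (Suc n))" by (simp add: divide_simps)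
      finally show ?thesis .
    qed
    hence "cball 1 (2 / R) \<subseteq> C n"
      by (auto simp: C_def)
    hence "measure circle_measure (cball 1 (2 / R)) \<le> measure circle_measure (C n)"
      by (intro finite_measure_mono) (auto simp: C_def)
    with n show "measure circle_measure (cball 1 (2 / R)) \<le> \<epsilon>" by simp
  qed simp
qed

text \<open>Continuity supplies a non-tangential limit. Uniqueness, required by \<open>THE\<close>,
  holds because the boundary point is a limit point of a Stolz region.\<close>

lemma boundary_value_eq:
  assumes "continuous_on S f" "unit_disk \<subseteq> S" "\<zeta> \<in> S" "norm \<zeta> = 1"
  shows "boundary_value f \<zeta> = f \<zeta>"
  unfolding boundary_value_def
proof (rule the_equality)
  have "(f \<longlongrightarrow> f \<zeta>) (at \<zeta> within S)"
    using assms(1,3) by (simp add: continuous_on_def)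
  moreover have "stolz_region \<alpha> \<zeta> \<subseteq> S" for \<alpha>
    using assms(2) by (auto simp: stolz_region_def)
  ultimately show nt: "has_nontangential_limit f \<zeta> (f \<zeta>)"
    unfolding has_nontangential_limit_def by (blast intro: tendsto_within_subset)
  fix L assume L: "has_nontangential_limit f \<zeta> L"
  have "\<zeta> islimpt stolz_region 2 \<zeta>"
    unfolding islimpt_approachable
  proof (intro allI impI)
    fix e :: real assume "e > 0"
    \<comment> \<open>The radial point \<open>(1 - d) * \<zeta>\<close> is at distance exactly
      \<open>d\<close> both from \<open>\<zeta>\<close> and from the circle, so aperture 2 contains
      it.\<close>
    define d where "d = min (e / 2) (1 / 2)"
    have d: "0 < d" "d < e" "d < 1" using \<open>e > 0\<close> by (auto simp: d_def)
    define x where "x = of_real (1 - d) * \<zeta>"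
    have nx: "norm x = 1 - d" using d assms(4) by (simp add: x_def norm_mult del: of_real_diff)
    have "x - \<zeta> = of_real (- d) * \<zeta>" by (simp add: x_def algebra_simps)
    hence dx: "norm (x - \<zeta>) = d" using d assms(4) by (simp add: norm_mult)
    have "x \<in> stolz_region 2 \<zeta>" using nx dx d by (simp add: stolz_region_def)
    moreover have "x \<noteq> \<zeta>" using dx d by auto
    moreover have "dist x \<zeta> < e" using dx d by (simp add: dist_norm)
    ultimately show "\<exists>x'\<in>stolz_region 2 \<zeta>. x' \<noteq> \<zeta> \<and> dist x' \<zeta> < e" by blast
  qed
  hence "at \<zeta> within stolz_region 2 \<zeta> \<noteq> bot"
    by (simp add: trivial_limit_within)
  thus "L = f \<zeta>"
    using L nt unfolding has_nontangential_limit_def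
    by (intro tendsto_unique[of "at \<zeta> within stolz_region 2 \<zeta>" f]) auto
qed

text \<open>Moving radially out to the circle costs \<open>1 - r\<close>, which is at most the
  distance from the inner point to 1. Bounds at all radii are thereby controlled by the boundary
  point alone.\<close>

lemma norm_one_minus_circle_le:
  fixes \<zeta> :: complex
  assumes "norm \<zeta> = 1" "0 \<le> r" "r \<le> 1"
  shows "norm (1 - \<zeta>) \<le> 2 * norm (1 - of_real r * \<zeta>)"
proof -
  have "1 - \<zeta> = (1 - of_real r * \<zeta>) - of_real (1 - r) * \<zeta>"
    by (simp add: algebra_simps)
  hence "norm (1 - \<zeta>) \<le> norm (1 - of_real r * \<zeta>) + norm (of_real (1 - r) * \<zeta>)"
    by (metis norm_triangle_ineq4)
  also have "norm (of_real (1 - r) * \<zeta>) = 1 - r"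
    using assms by (simp add: norm_mult del: of_real_diff)
  also have "1 - r \<le> norm (1 - of_real r * \<zeta>)"
    using norm_triangle_ineq2[of 1 "of_real r * \<zeta>"] assms by (simp add: norm_mult)
  finally show ?thesis by simp
qed

text \<open>The staircase yields one integrable majorant \<open>G\<close> valid for all radii at
  once. It bounds the means, allows dominated convergence for the Smirnov condition, and bounds the
  \<open>\<Psi>\<close>-integral.\<close>

lemma Hardy_Orlicz_if_staircase_bound:
  fixes h :: "complex \<Rightarrow> complex" and M R \<Psi> :: "_ \<Rightarrow> real"
  assumes holo: "h holomorphic_on unit_disk"
    and cont: "continuous_on (cball 0 1 - {1}) h"
    and nonneg: "\<And>x. x \<ge> 0 \<Longrightarrow> \<Psi> x \<ge> 0"
    and mono: "mono_on {0..} \<Psi>"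
    and R: "filterlim R at_top sequentially" "\<And>n. R n > 0"
    and bound: "\<And>n z. z \<in> cball 0 1 \<Longrightarrow> norm (1 - z) \<ge> 1 / R n \<Longrightarrow> norm (h z) \<le> M n"
    and M: "\<And>n. M n \<ge> 0"
    and summable: "summable (\<lambda>n. measure circle_measure (cball 1 (2 / R n)) *
                     (\<Psi> (M (Suc n)) + M (Suc n)))"
  shows "h \<in> Hardy_Orlicz \<Psi>"
proof -
  interpret prob_space circle_measure by (rule prob_space_circle_measure)
  \<comment> \<open>The sum dominates both \<open>\<Psi>\<close> and \<open>log_plus\<close>, so one
    majorant serves both integrals.\<close>
  define F where "F x = \<Psi> x + x" for x
  define T where "T = sphere (0::complex) 1 - {1}"
  \<comment> \<open>The index shift is deliberate: a point that fails the distance test at level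
    \<open>n\<close> and first passes it at \<open>Suc n\<close> has value at most
    \<open>M (Suc n)\<close>, and its radial projection lies in the ball of radius
    \<open>2 / R n\<close>.\<close>
  define g where "g n \<zeta> = ennreal (F (M (Suc n))) * indicator (cball 1 (2 / R n)) \<zeta>"
    for n and \<zeta> :: complex
  define G where "G \<zeta> = ennreal (F (M 0)) +
      (\<Sum>n. g n \<zeta>)" for \<zeta> :: complex
  have F_mono: "F x \<le> F y" if "0 \<le> x" "x \<le> y" for x y
    using that mono_onD[OF mono, of x y] by (simp add: F_def)
  have F_nonneg: "F x \<ge> 0" if "x \<ge> 0" for x
    using that nonneg[of x] by (simp add: F_def)
  have [measurable]: "cball c s \<in> sets borel" for c :: complex and s by simp
  have [measurable]: "G \<in> borel_measurable borel"
    unfolding G_def g_def by measurable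
  have G_ge: "ennreal (F (norm (h (of_real r * \<zeta>)))) \<le> G \<zeta>"
    if "\<zeta> \<in> T" "0 \<le> r" "r \<le> 1" for r \<zeta>
  proof -
    let ?z = "of_real r * \<zeta>"
    have z: "?z \<in> cball 0 1" using that by (simp add: T_def norm_mult)
    have "norm (1 - \<zeta>) > 0" using that by (auto simp: T_def)
    hence pos: "norm (1 - ?z) > 0"
      using norm_one_minus_circle_le[of \<zeta> r] that by (auto simp: T_def)
    have "\<exists>n. 1 / norm (1 - ?z) \<le> R n"
      using R(1) by (auto simp: filterlim_at_top eventually_sequentially)
    hence ex: "\<exists>n. norm (1 - ?z) \<ge> 1 / R n"
      using pos R(2) by (auto simp: field_simps)
    define n where "n = (LEAST n. norm (1 - ?z) \<ge> 1 / R n)"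
    have n: "norm (1 - ?z) \<ge> 1 / R n" unfolding n_def by (rule LeastI_ex[OF ex])
    have less: "F (norm (h ?z)) \<le> F (M n)"
      using bound[OF z n] by (intro F_mono) auto
    show ?thesis
    proof (cases n)
      case 0
      have "ennreal (F (norm (h ?z))) \<le> ennreal (F (M 0)) + 0"
        using less 0 by (simp add: ennreal_leI)
      also have "\<dots> \<le> G \<zeta>" unfolding G_def by (rule add_left_mono) simp
      finally show ?thesis .
    next
      case (Suc m)
      have "\<not> norm (1 - ?z) \<ge> 1 / R m"
        using Suc not_less_Least[of m "\<lambda>n. norm (1 - ?z) \<ge> 1 / R n"] by (simp add: n_def)
      hence "norm (1 - \<zeta>) \<le> 2 / R m"
        using norm_one_minus_circle_le[of \<zeta> r] that by (auto simp: T_def)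
      hence "ennreal (F (norm (h ?z))) \<le> ennreal (F (M (Suc m))) * indicator (cball 1 (2 / R m)) \<zeta>"
        using less Suc by (simp add: dist_norm ennreal_leI)
      also have "\<dots> = g m \<zeta>"
        by (simp add: g_def)
      also have "\<dots> = (\<Sum>n\<in>{m}. g n \<zeta>)"
        by simp
      also have "\<dots> \<le> (\<Sum>n. g n \<zeta>)"
        by (rule sum_le_suminf) auto
      also have "\<dots> \<le> G \<zeta>" unfolding G_def by simp
      finally show ?thesis .
    qed
  qed
  have G_fin: "(\<integral>\<^sup>+\<zeta>. G \<zeta> \<partial>circle_measure) < \<infinity>"
  proof -
    have "(\<integral>\<^sup>+\<zeta>. G \<zeta> \<partial>circle_measure) = ennreal (F (M 0)) +
        (\<Sum>n. ennreal (F (M (Suc n))) * emeasure circle_measure (cball 1 (2 / R n)))"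
      unfolding G_def g_def
      by (subst nn_integral_add, simp, simp, subst nn_integral_suminf)
         (simp_all add: nn_integral_cmult_indicator emeasure_space_1[simplified])
    also have "(\<lambda>n. ennreal (F (M (Suc n))) * emeasure circle_measure (cball 1 (2 / R n))) =
        (\<lambda>n. ennreal (measure circle_measure (cball 1 (2 / R n)) * F (M (Suc n))))"
      by (simp add: emeasure_eq_measure ennreal_mult' F_nonneg M mult.commute)
    also have "(\<Sum>n. ennreal (measure circle_measure (cball 1 (2 / R n)) * F (M (Suc n)))) < \<infinity>"
      using summable by (simp add: suminf_ennreal2 F_nonneg M F_def[symmetric])
    finally show ?thesis by simp
  qed
  have AE_T: "AE \<zeta> in circle_measure. \<zeta> \<in> T"
    using AE_circle_measure by (simp add: T_def)
  have bv: "boundary_value h \<zeta> = h \<zeta>" if "\<zeta> \<in> T" for \<zeta>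
    by (rule boundary_value_eq[OF cont]) (use that in \<open>auto simp: T_def\<close>)
  have log_le: "log_plus x \<le> F x" if "x \<ge> 0" for x
    using that nonneg[of x] ln_le_minus_one[of "max 1 x"]
    by (auto simp: log_plus_def F_def max_def)
  have log_le_G: "ennreal (log_plus (norm (h (of_real r * \<zeta>)))) \<le> G \<zeta>"
    if "\<zeta> \<in> T" "0 \<le> r" "r \<le> 1" for r \<zeta>
    using order_trans[OF ennreal_leI[OF log_le] G_ge[OF that]] by simp
  have "log_plus_mean h r \<le> (\<integral>\<^sup>+\<zeta>. G \<zeta> \<partial>circle_measure)" if "r \<in> {0..<1}" for r
    unfolding log_plus_mean_def using that AE_T
    by (intro nn_integral_mono_AE) (auto elim!: eventually_mono intro!: log_le_G)
  hence "(SUP r\<in>{0..<1}. log_plus_mean h r) < \<infinity>"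
    by (intro le_less_trans[OF SUP_least G_fin])
  hence nev: "h \<in> Nevanlinna_class"
    using holo by (simp add: Nevanlinna_class_def Hol_disk_def)
  \<comment> \<open>The indicator discards a null set, namely 1 and all points off the circle, so
    that measurability follows from continuity on \<open>T\<close>.\<close>
  define u where "u r \<zeta> = ennreal (log_plus (norm (h (of_real r * \<zeta>)))) * indicator T \<zeta>"
    for r :: real and \<zeta>
  have cont_h: "continuous_on T (\<lambda>\<zeta>. h (of_real r * \<zeta>))" if "0 \<le> r" "r \<le> 1" for r
  proof (rule continuous_on_compose2[OF cont])
    show "(\<lambda>\<zeta>. of_real r * \<zeta>) ` T \<subseteq> cball 0 1 - {1}"
    proof (intro image_subsetI)
      fix \<zeta> assume \<zeta>: "\<zeta> \<in> T"
      have "norm (1 - \<zeta>) > 0" using \<zeta> by (auto simp: T_def)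
      hence "norm (1 - of_real r * \<zeta>) > 0"
        using norm_one_minus_circle_le[of \<zeta> r] that \<zeta> by (auto simp: T_def)
      thus "of_real r * \<zeta> \<in> cball 0 1 - {1}"
        using that \<zeta> by (auto simp: T_def norm_mult)
    qed
  qed (intro continuous_intros)
  have T_borel: "T \<in> sets borel" by (simp add: T_def)
  have u_meas [measurable]: "u r \<in> borel_measurable borel" if "0 \<le> r" "r \<le> 1" for r
  proof -
    have "continuous_on T (\<lambda>\<zeta>. log_plus (norm (h (of_real r * \<zeta>))))"
      unfolding log_plus_def using cont_h[OF that] by (intro continuous_intros) auto
    hence "(\<lambda>\<zeta>. indicator T \<zeta> *\<^sub>R log_plus (norm (h (of_real r * \<zeta>)))) \<in> borel_measurable borel"
      by (rule borel_measurable_continuous_on_indicator[OF T_borel])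
    hence "(\<lambda>\<zeta>. ennreal (indicator T \<zeta> *\<^sub>R log_plus (norm (h (of_real r * \<zeta>)))))
        \<in> borel_measurable borel"
      by measurable
    also have "(\<lambda>\<zeta>. ennreal (indicator T \<zeta> *\<^sub>R log_plus (norm (h (of_real r * \<zeta>))))) = u r"
      by (auto simp: u_def fun_eq_iff indicator_def)
    finally show ?thesis .
  qed
  have mean_eq: "log_plus_mean h r = (\<integral>\<^sup>+\<zeta>. u r \<zeta> \<partial>circle_measure)" for r
    unfolding log_plus_mean_def u_def using AE_T
    by (intro nn_integral_cong_AE) (auto elim!: eventually_mono)
  have bv_eq: "(\<integral>\<^sup>+\<zeta>. ennreal (log_plus (norm (boundary_value h \<zeta>))) \<partial>circle_measure)
      = (\<integral>\<^sup>+\<zeta>. u 1 \<zeta> \<partial>circle_measure)"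
    unfolding u_def using AE_T
    by (intro nn_integral_cong_AE) (auto elim!: eventually_mono simp: bv)
  have "((\<lambda>r. \<integral>\<^sup>+\<zeta>. u r \<zeta> \<partial>circle_measure) \<longlongrightarrow> (\<integral>\<^sup>+\<zeta>. u 1 \<zeta> \<partial>circle_measure)) (at_left 1)"
  proof (rule tendsto_at_left_sequentially[of 0])
    fix S :: "nat \<Rightarrow> real"
    assume S: "\<And>n. S n < 1" "\<And>n. 0 < S n" "S \<longlonglongrightarrow> 1"
    show "(\<lambda>n. \<integral>\<^sup>+\<zeta>. u (S n) \<zeta> \<partial>circle_measure) \<longlonglongrightarrow> (\<integral>\<^sup>+\<zeta>. u 1 \<zeta> \<partial>circle_measure)"
    proof (rule nn_integral_dominated_convergence[where w = G])
      show "AE \<zeta> in circle_measure. u (S n) \<zeta> \<le> G \<zeta>" for n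
        using S(1,2)[of n] log_le_G[of _ "S n"] by (auto simp: u_def indicator_def less_imp_le)
      have "(\<lambda>n. u (S n) \<zeta>) \<longlonglongrightarrow> u 1 \<zeta>" if \<zeta>: "\<zeta> \<in> T" for \<zeta>
      proof -
        have "(\<lambda>n. h (of_real (S n) * \<zeta>)) \<longlonglongrightarrow> h \<zeta>"
        proof (rule continuous_on_tendsto_compose[OF cont])
          show "(\<lambda>n. of_real (S n) * \<zeta>) \<longlonglongrightarrow> \<zeta>"
            using tendsto_mult[OF tendsto_of_real[OF S(3)] tendsto_const[of \<zeta>]] by simp
          show "\<zeta> \<in> cball 0 1 - {1}" using \<zeta> by (auto simp: T_def)
          have "norm (of_real (S n) * \<zeta>) < 1" for n
            using S(1,2)[of n] \<zeta> by (simp add: T_def norm_mult)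
          thus "\<forall>\<^sub>F n in sequentially. of_real (S n) * \<zeta> \<in> cball 0 1 - {1}"
            by (intro always_eventually allI) (auto simp: less_imp_le, metis less_irrefl norm_one)
        qed
        hence "(\<lambda>n. ennreal (log_plus (norm (h (of_real (S n) * \<zeta>)))))
            \<longlonglongrightarrow> ennreal (log_plus (norm (h \<zeta>)))"
          unfolding log_plus_def by (intro tendsto_intros) auto
        thus ?thesis using \<zeta> by (simp add: u_def)
      qed
      thus "AE \<zeta> in circle_measure. (\<lambda>n. u (S n) \<zeta>) \<longlonglongrightarrow> u 1 \<zeta>"
        using AE_T by (auto elim!: eventually_mono)
    qed (use S G_fin in \<open>auto simp: less_imp_le\<close>)
  qed auto
  hence "h \<in> Smirnov_class"
    using nev by (simp add: Smirnov_class_def bv_eq mean_eq[abs_def])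
  moreover have "(\<integral>\<^sup>+\<zeta>. ennreal (\<Psi> (norm (boundary_value h \<zeta>))) \<partial>circle_measure)
      \<le> (\<integral>\<^sup>+\<zeta>. G \<zeta> \<partial>circle_measure)"
  proof (rule nn_integral_mono_AE)
    have "ennreal (\<Psi> (norm (boundary_value h \<zeta>))) \<le> G \<zeta>" if "\<zeta> \<in> T" for \<zeta>
    proof -
      have "ennreal (\<Psi> (norm (boundary_value h \<zeta>))) \<le> ennreal (F (norm (h \<zeta>)))"
        using that by (intro ennreal_leI) (simp add: bv F_def)
      also have "\<dots> \<le> G \<zeta>" using G_ge[OF that, of 1] by simp
      finally show ?thesis .
    qed
    thus "AE \<zeta> in circle_measure. ennreal (\<Psi> (norm (boundary_value h \<zeta>))) \<le> G \<zeta>"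
      using AE_T by (auto elim!: eventually_mono)
  qed
  ultimately show ?thesis
    using G_fin by (auto simp: Hardy_Orlicz_def intro: le_less_trans)
qed

subsection \<open>Newton interpolation at radial nodes\<close>

text \<open>
  In the coordinate \<open>w = 1 / (1 - z)\<close>, which sends the node \<open>1 - 1 / p\<^sub>j\<close> to \<open>p\<^sub>j\<close> and the disk to the
  half-plane \<open>Re w > 1/2\<close>, this is \<open>w / (w + p\<^sub>j)\<close> times the product of \<open>(w - p\<^sub>k) / (w + p\<^sub>k)\<close>.
\<close>

definition newton_basis :: "(nat \<Rightarrow> real) \<Rightarrow> nat \<Rightarrow> complex \<Rightarrow> complex" where
  "newton_basis p j z = 1 / (1 + of_real (p j) * (1 - z)) *
     (\<Prod>k<j. (1 - of_real (p k) * (1 - z)) / (1 + of_real (p k) * (1 - z)))"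

text \<open>Everything rests on \<open>p * Re q\<close> being nonnegative; for the last two bounds
  it is, up to a factor, the cross term of the squared modulus.\<close>

lemma norm_one_plus_ge:
  fixes q :: complex
  assumes "Re q \<ge> 0" "p \<ge> 0"
  shows "norm (1 + of_real p * q) \<ge> 1"
    and "norm (1 + of_real p * q) \<ge> p * norm q"
    and "norm (1 - of_real p * q) \<le> norm (1 + of_real p * q)"
proof -
  have Re: "p * Re q \<ge> 0" using assms by simp
  show "norm (1 + of_real p * q) \<ge> 1"
    using complex_Re_le_cmod[of "1 + of_real p * q"] Re by simp
  have "(p * norm q)\<^sup>2 \<le> (norm (1 + of_real p * q))\<^sup>2"
    using Re by (simp add: cmod_power2 power_mult_distrib) (simp add: algebra_simps power2_eq_square)
  thus "norm (1 + of_real p * q) \<ge> p * norm q"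
    by (rule power2_le_imp_le) simp
  have "(norm (1 - of_real p * q))\<^sup>2 \<le> (norm (1 + of_real p * q))\<^sup>2"
    using Re by (simp add: cmod_power2 power_mult_distrib) (simp add: algebra_simps power2_eq_square)
  thus "norm (1 - of_real p * q) \<le> norm (1 + of_real p * q)"
    by (rule power2_le_imp_le) simp
qed

lemma one_plus_nonzero:
  fixes q :: complex
  assumes "Re q \<ge> 0" "p \<ge> 0"
  shows "1 + of_real p * q \<noteq> 0"
  using norm_one_plus_ge(1)[OF assms] by auto

text \<open>The factors of the product have modulus at most 1 in this half-plane, so only the
  leading factor counts. Its decay in \<open>p j\<close> makes the series converge away from
  1.\<close>

lemma norm_newton_basis_le:
  assumes "\<And>k. p k > 0" "Re z \<le> 1"
  shows "norm (newton_basis p j z) \<le> 1"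
    and "z \<noteq> 1 \<Longrightarrow> norm (newton_basis p j z) \<le> 1 / (p j * norm (1 - z))"
proof -
  have p: "p k \<ge> 0" for k using assms(1)[of k] by simp
  have q: "Re (1 - z) \<ge> 0" using assms(2) by simp
  note ge = norm_one_plus_ge[OF q p]
  let ?P = "\<Prod>k<j. (1 - of_real (p k) * (1 - z)) / (1 + of_real (p k) * (1 - z))"
  have P: "norm ?P \<le> 1"
    unfolding prod_norm[symmetric]
  proof (intro prod_le_1 conjI)
    fix k
    show "norm ((1 - of_real (p k) * (1 - z)) / (1 + of_real (p k) * (1 - z))) \<le> 1"
      using ge(1,3)[of k] by (simp add: norm_divide divide_le_eq)
  qed simp
  have "norm (newton_basis p j z) = norm (1 / (1 + of_real (p j) * (1 - z))) * norm ?P"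
    unfolding newton_basis_def by (rule norm_mult)
  also have "\<dots> \<le> norm (1 / (1 + of_real (p j) * (1 - z))) * 1"
    by (intro mult_left_mono P) simp
  also have "\<dots> = 1 / norm (1 + of_real (p j) * (1 - z))"
    by (simp add: norm_divide)
  finally have le: "norm (newton_basis p j z) \<le> 1 / norm (1 + of_real (p j) * (1 - z))" .
  also have "\<dots> \<le> 1"
    using ge(1)[of j] by (simp add: divide_le_eq)
  finally show "norm (newton_basis p j z) \<le> 1" .
  assume "z \<noteq> 1"
  hence "1 / norm (1 + of_real (p j) * (1 - z)) \<le> 1 / (p j * norm (1 - z))"
    using ge(1,2)[of j] assms(1)[of j] by (intro divide_left_mono mult_pos_pos) auto
  with le show "norm (newton_basis p j z) \<le> 1 / (p j * norm (1 - z))" by linarith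
qed

lemma newton_basis_eq_0:
  assumes "p k \<noteq> 0" "k < j"
  shows "newton_basis p j (of_real (1 - 1 / p k)) = 0"
proof -
  have "(\<Prod>i<j. (1 - of_real (p i) * (1 - of_real (1 - 1 / p k))) /
           (1 + of_real (p i) * (1 - of_real (1 - 1 / p k)))) = (0::complex)"
    using assms by (intro prod_zero bexI[of _ k]) auto
  thus ?thesis by (simp add: newton_basis_def)
qed

text \<open>At its own node the leading factor is 1/2 and each other factor is
  \<open>(p j - p k) / (p j + p k)\<close>, bounded below by the relative separation. The resulting
  bound depends on \<open>j\<close> only.\<close>

lemma norm_newton_basis_diag_ge:
  assumes "\<And>k. p k > 0" "\<And>k. k < j \<Longrightarrow> (1 + 1 / (real j + 1)) * p k \<le> p j"
  shows "norm (newton_basis p j (of_real (1 - 1 / p j))) \<ge> 1 / (2 * (3 * (real j + 1)) ^ j)"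
proof -
  let ?z = "of_real (1 - 1 / p j) :: complex"
  have pj: "p j > 0" by (rule assms)
  have z: "1 - ?z = of_real (1 / p j)" by simp
  have "1 / (3 * (real j + 1)) \<le>
      norm ((1 - of_real (p k) * (1 - ?z)) / (1 + of_real (p k) * (1 - ?z)))" if "k < j" for k
  proof -
    define d where "d = 1 / (real j + 1)"
    have d: "0 < d" "d \<le> 1" by (auto simp: d_def)
    have pk: "p k > 0" by (rule assms)
    have le: "(1 + d) * p k \<le> p j" using assms(2)[OF that] by (simp add: d_def)
    have dp: "0 < d * p k" using d pk by simp
    have "(1 - of_real (p k) * (1 - ?z)) / (1 + of_real (p k) * (1 - ?z)) =
        of_real ((1 - p k * (1 / p j)) / (1 + p k * (1 / p j)))"
      unfolding z by simp
    also have "(1 - p k * (1 / p j)) / (1 + p k * (1 / p j)) = (p j - p k) / (p j + p k)"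
    proof -
      have "1 - p k * (1 / p j) = (p j - p k) / p j" "1 + p k * (1 / p j) = (p j + p k) / p j"
        using pj by (auto simp: field_simps)
      thus ?thesis using pj by simp
    qed
    finally have "norm ((1 - of_real (p k) * (1 - ?z)) / (1 + of_real (p k) * (1 - ?z))) =
        (p j - p k) / (p j + p k)"
      using pj pk le dp by (simp add: norm_of_real abs_of_nonneg algebra_simps del: of_real_divide)
    moreover have "d / 3 \<le> (p j - p k) / (p j + p k)"
    proof -
      \<comment> \<open>The target amounts to \<open>(3 + d) * p k \<le> (3 - d) * p j\<close>, and
        \<open>(3 - d) * (1 + d) \<ge> 3 + d\<close> because \<open>d \<le> 1\<close>.\<close>
      have "(3 - d) * ((1 + d) * p k) \<le> (3 - d) * p j"
        using d le by (intro mult_left_mono) auto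
      moreover have "d * d * p k \<le> 1 * d * p k"
        using d pk by (intro mult_right_mono) auto
      ultimately have "d * (p j + p k) \<le> 3 * (p j - p k)"
        by (simp add: algebra_simps)
      thus ?thesis using pj pk by (simp add: field_simps)
    qed
    ultimately show ?thesis by (simp add: d_def mult.commute)
  qed
  hence "(\<Prod>k<j. 1 / (3 * (real j + 1))) \<le>
      (\<Prod>k<j. norm ((1 - of_real (p k) * (1 - ?z)) / (1 + of_real (p k) * (1 - ?z))))"
    by (intro prod_mono) auto
  hence "1 / 2 * (1 / (3 * (real j + 1))) ^ j \<le> 1 / 2 *
      (\<Prod>k<j. norm ((1 - of_real (p k) * (1 - ?z)) / (1 + of_real (p k) * (1 - ?z))))"
    by simp
  also have "\<dots> = norm (newton_basis p j ?z)"
    unfolding newton_basis_def norm_mult prod_norm[symmetric] z using pj by simp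
  finally show ?thesis by (simp add: power_one_over)
qed

text \<open>Forward substitution in the triangular system that prescribes the value
  \<open>c j\<close> at node \<open>j\<close>.\<close>

fun newton_coeff :: "(nat \<Rightarrow> real) \<Rightarrow> (nat \<Rightarrow> complex) \<Rightarrow> nat \<Rightarrow> complex" where
  "newton_coeff p c j =
     (c j - (\<Sum>k<j. newton_coeff p c k * newton_basis p k (of_real (1 - 1 / p j)))) /
     newton_basis p j (of_real (1 - 1 / p j))"

text \<open>The prefactor is the reciprocal of the diagonal lower bound and the bracket bounds the
  numerator of \<open>newton_coeff\<close>. Neither nodes nor data occur, so nodes may later be
  chosen in terms of these numbers.\<close>

fun newton_bound :: "nat \<Rightarrow> real" where
  "newton_bound j = 2 * (3 * (real j + 1)) ^ j * (1 + (\<Sum>k<j. newton_bound k))"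

declare newton_coeff.simps [simp del] newton_bound.simps [simp del]

lemma newton_bound_ge_1: "newton_bound j \<ge> 1"
proof (induction j rule: less_induct)
  case (less j)
  have "(\<Sum>k<j. newton_bound k) \<ge> 0"
    using less by (intro sum_nonneg) (auto intro: order_trans[of 0 1])
  moreover have "(1::real) \<le> (3 * (real j + 1)) ^ j" by (intro one_le_power) auto
  ultimately have "1 * 1 \<le> (2 * (3 * (real j + 1)) ^ j) * (1 + (\<Sum>k<j. newton_bound k))"
    by (intro mult_mono) linarith+
  thus ?case by (subst newton_bound.simps) simp
qed

lemma norm_newton_coeff_le:
  assumes p: "\<And>k. p k > 0" "\<And>j k. k < j \<Longrightarrow> (1 + 1 / (real j + 1)) * p k \<le> p j"
    and c: "\<And>j. norm (c j) \<le> 1"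
  shows "norm (newton_coeff p c j) \<le> newton_bound j"
proof (induction j rule: less_induct)
  case (less j)
  let ?z = "of_real (1 - 1 / p j) :: complex"
  have Re: "Re ?z \<le> 1" using p(1)[of j] by simp
  have "norm (c j - (\<Sum>k<j. newton_coeff p c k * newton_basis p k ?z)) \<le>
      norm (c j) + norm (\<Sum>k<j. newton_coeff p c k * newton_basis p k ?z)"
    by (rule norm_triangle_ineq4)
  also have "\<dots> \<le> 1 + (\<Sum>k<j. newton_bound k)"
  proof (intro add_mono c order_trans[OF norm_sum] sum_mono)
    fix k assume "k \<in> {..<j}"
    hence "norm (newton_coeff p c k) * norm (newton_basis p k ?z) \<le> newton_bound k * 1"
      using less norm_newton_basis_le(1)[OF p(1) Re] newton_bound_ge_1[of k]
      by (intro mult_mono) auto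
    thus "norm (newton_coeff p c k * newton_basis p k ?z) \<le> newton_bound k"
      by (simp add: norm_mult)
  qed
  finally have num: "norm (c j - (\<Sum>k<j. newton_coeff p c k * newton_basis p k ?z)) \<le>
    1 + (\<Sum>k<j. newton_bound k)" .
  have "norm (newton_coeff p c j) =
      norm (c j - (\<Sum>k<j. newton_coeff p c k * newton_basis p k ?z)) / norm (newton_basis p j ?z)"
    by (subst newton_coeff.simps) (simp add: norm_divide)
  also have "\<dots> \<le> (1 + (\<Sum>k<j. newton_bound k)) / (1 / (2 * (3 * (real j + 1)) ^ j))"
  proof (rule frac_le)
    show "0 \<le> 1 + (\<Sum>k<j. newton_bound k)" using num norm_ge_zero order_trans by blast
    show "1 / (2 * (3 * (real j + 1)) ^ j) \<le> norm (newton_basis p j ?z)"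
      using p by (rule norm_newton_basis_diag_ge)
  qed (use num in auto)
  also have "\<dots> = newton_bound j" by (simp add: newton_bound.simps[of j])
  finally show ?case .
qed

section \<open>The Newton series: interpolation, holomorphy, continuity up to the circle\<close>

definition newton_series :: "(nat \<Rightarrow> real) \<Rightarrow> (nat \<Rightarrow> complex) \<Rightarrow> complex \<Rightarrow> complex" where
  "newton_series p c z = (\<Sum>j. newton_coeff p c j * newton_basis p j z)"

lemma newton_series_interpolates:
  \<comment> \<open>At node \<open>m\<close> all later terms vanish, and the coefficient of index
    \<open>m\<close> was chosen to correct the finite sum to \<open>c m\<close>.\<close>
  assumes p: "\<And>k. p k > 0" "\<And>j k. k < j \<Longrightarrow> (1 + 1 / (real j + 1)) * p k \<le> p j"
  shows "newton_series p c (of_real (1 - 1 / p m)) = c m"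
proof -
  let ?z = "of_real (1 - 1 / p m) :: complex"
  have "norm (newton_basis p m ?z) > 0"
    by (rule less_le_trans[OF _ norm_newton_basis_diag_ge]) (use p in auto)
  hence nz: "newton_basis p m ?z \<noteq> 0" by simp
  have "newton_series p c ?z = (\<Sum>j\<in>{..<Suc m}. newton_coeff p c j * newton_basis p j ?z)"
    unfolding newton_series_def
  proof (rule suminf_finite)
    fix j assume "j \<notin> {..<Suc m}"
    hence "m < j" by simp
    thus "newton_coeff p c j * newton_basis p j ?z = 0"
      using newton_basis_eq_0[of p m j] p(1)[of m] by simp
  qed simp
  also have "\<dots> = (\<Sum>j<m. newton_coeff p c j * newton_basis p j ?z) +
      newton_coeff p c m * newton_basis p m ?z" by simp
  also have "\<dots> = c m"
    using nz by (simp add: newton_coeff.simps[of p c m])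
  finally show ?thesis .
qed

text \<open>Weierstrass test with the decay estimate for the basis. The region reaches the circle,
  so it serves both holomorphy inside and continuity on the boundary.\<close>

lemma newton_series_uniform_limit:
  assumes p: "\<And>k. p k > 0" "summable (\<lambda>j. norm (newton_coeff p c j) / p j)" and "s > 0"
  shows "uniform_limit {z. Re z \<le> 1 \<and> s \<le> norm (1 - z)}
           (\<lambda>n z. \<Sum>j<n. newton_coeff p c j * newton_basis p j z) (newton_series p c) sequentially"
  unfolding newton_series_def
proof (rule Weierstrass_m_test)
  show "summable (\<lambda>j. norm (newton_coeff p c j) / p j * (1 / s))"
    using p(2) by (rule summable_mult2)
  fix j z assume z: "z \<in> {z. Re z \<le> 1 \<and> s \<le> norm (1 - z)}"
  hence "z \<noteq> 1" using \<open>s > 0\<close> by auto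
  hence "norm (newton_basis p j z) \<le> 1 / (p j * norm (1 - z))"
    using z p(1) by (intro norm_newton_basis_le(2)) auto
  also have "\<dots> \<le> 1 / (p j * s)"
    using z p(1)[of j] \<open>s > 0\<close> by (intro divide_left_mono mult_left_mono mult_pos_pos) auto
  finally have "norm (newton_coeff p c j) * norm (newton_basis p j z) \<le>
      norm (newton_coeff p c j) * (1 / (p j * s))"
    by (rule mult_left_mono) simp
  thus "norm (newton_coeff p c j * newton_basis p j z) \<le> norm (newton_coeff p c j) / p j * (1 / s)"
    by (simp add: norm_mult)
qed

lemma newton_basis_holomorphic:
  assumes "\<And>k. p k > 0"
  shows "newton_basis p j holomorphic_on unit_disk"
    and "continuous_on {z. Re z \<le> 1} (newton_basis p j)"
proof -
  have "1 + of_real (p k) * (1 - z) \<noteq> 0" if "Re z \<le> 1" for k z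
    using that assms[of k] by (intro one_plus_nonzero) auto
  moreover have "Re z \<le> 1" if "z \<in> unit_disk" for z
    using that complex_Re_le_cmod[of z] by simp
  ultimately show "newton_basis p j holomorphic_on unit_disk"
    and "continuous_on {z. Re z \<le> 1} (newton_basis p j)"
    unfolding newton_basis_def by (auto intro!: holomorphic_intros continuous_intros)
qed

lemma newton_series_holomorphic:
  assumes p: "\<And>k. p k > 0" "summable (\<lambda>j. norm (newton_coeff p c j) / p j)"
  shows "newton_series p c holomorphic_on unit_disk"
proof (rule holomorphic_uniform_sequence)
  show "(\<lambda>z. \<Sum>j<n. newton_coeff p c j * newton_basis p j z) holomorphic_on unit_disk" for n
    by (intro holomorphic_intros newton_basis_holomorphic p(1))
  fix z assume z: "z \<in> unit_disk"
  \<comment> \<open>Half the distance to the circle: the closed ball around \<open>z\<close> stays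
    at distance at least \<open>d\<close> from 1.\<close>
  define d where "d = (1 - norm z) / 2"
  have d: "d > 0" "norm z + 2 * d = 1" using z by (auto simp: d_def field_simps)
  have w: "norm w \<le> norm z + d" if "w \<in> cball z d" for w
    using that norm_triangle_sub[of w z] by (simp add: dist_norm norm_minus_commute)
  have "cball z d \<subseteq> unit_disk" using w d by fastforce
  moreover have "cball z d \<subseteq> {w. Re w \<le> 1 \<and> d \<le> norm (1 - w)}"
  proof
    fix u assume "u \<in> cball z d"
    thus "u \<in> {w. Re w \<le> 1 \<and> d \<le> norm (1 - w)}"
      using w[of u] d complex_Re_le_cmod[of u] norm_triangle_ineq2[of 1 u] by simp
  qed
  ultimately show "\<exists>d>0. cball z d \<subseteq> unit_disk \<and> uniform_limit (cball z d)
      (\<lambda>n z. \<Sum>j<n. newton_coeff p c j * newton_basis p j z) (newton_series p c) sequentially"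
    using newton_series_uniform_limit[OF p d(1)] d(1)
    by (intro exI[of _ d]) (auto intro: uniform_limit_on_subset)
qed simp

lemma newton_series_continuous:
  assumes p: "\<And>k. p k > 0" "summable (\<lambda>j. norm (newton_coeff p c j) / p j)"
  shows "continuous_on (cball 0 1 - {1}) (newton_series p c)"
  unfolding continuous_on_eq_continuous_within
proof
  fix z :: complex assume z: "z \<in> cball 0 1 - {1}"
  define s where "s = norm (1 - z) / 2"
  have s: "s > 0" "norm (1 - z) = 2 * s" using z by (auto simp: s_def)
  define T where "T = {z. Re z \<le> 1 \<and> s \<le> norm (1 - z)}"
  have "continuous_on T (newton_series p c)"
    unfolding T_def
  proof (rule uniform_limit_theorem[OF _ newton_series_uniform_limit[OF p s(1)]])
    have "continuous_on {z. Re z \<le> 1 \<and> s \<le> cmod (1 - z)} (newton_basis p j)" for j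
      by (rule continuous_on_subset[OF newton_basis_holomorphic(2)[OF p(1)]]) auto
    thus "\<forall>\<^sub>F n in sequentially. continuous_on {z. Re z \<le> 1 \<and> s \<le> cmod (1 - z)}
        (\<lambda>z. \<Sum>j<n. newton_coeff p c j * newton_basis p j z)"
      by (intro always_eventually allI continuous_intros)
  qed simp
  hence "continuous_on ((cball 0 1 - {1}) \<inter> ball z s) (newton_series p c)"
  proof (rule continuous_on_subset)
    show "(cball 0 1 - {1}) \<inter> ball z s \<subseteq> T"
    proof
      fix u assume "u \<in> (cball 0 1 - {1}) \<inter> ball z s"
      thus "u \<in> T"
        using complex_Re_le_cmod[of u] norm_triangle_ineq[of "1 - u" "u - z"] s
        by (auto simp: T_def dist_norm norm_minus_commute)
    qed
  qed
  hence "continuous (at z within (cball 0 1 - {1}) \<inter> ball z s) (newton_series p c)"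
    using z s by (simp add: continuous_on_eq_continuous_within)
  moreover have "at z within (cball 0 1 - {1}) \<inter> ball z s = at z within (cball 0 1 - {1})"
    using s by (intro at_within_nhd[of z "ball z s"]) auto
  ultimately show "continuous (at z within (cball 0 1 - {1})) (newton_series p c)"
    by (simp add: continuous_within)
qed

subsection \<open>Pairs of close nodes\<close>

text \<open>The substitution turns \<open>(a - b) / (1 - a * b)\<close> into
  \<open>(p - q) / (p + q - 1)\<close>. The first formula measures closeness within a pair, the
  second gives convergence of the Blaschke product.\<close>

lemma norm_blaschke_factor_real:
  assumes "p > 1" "q > 1"
  shows "norm (blaschke_factor (of_real (1 - 1 / p)) (of_real (1 - 1 / q))) = \<bar>p - q\<bar> / (p + q - 1)"
    and "norm (blaschke_factor (of_real (1 - 1 / p)) (of_real (1 - 1 / q)) - 1) \<le> 2 * q / p"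
proof -
  define a b where "a = 1 - 1 / p" and "b = 1 - 1 / q"
  have a: "0 < a" "a < 1" and b: "0 < b" "b < 1" using assms by (auto simp: a_def b_def)
  have eq: "blaschke_factor (of_real a) (of_real b) = of_real ((a - b) / (1 - a * b))"
    using a by (simp add: blaschke_factor_def)
  have "(a - b) / (1 - a * b) = (p - q) / (p + q - 1)"
    unfolding a_def b_def using assms by (simp add: divide_simps) (simp add: algebra_simps)
  with eq have eq': "blaschke_factor (of_real a) (of_real b) = of_real ((p - q) / (p + q - 1))"
    by simp
  show "norm (blaschke_factor (of_real (1 - 1 / p)) (of_real (1 - 1 / q))) = \<bar>p - q\<bar> / (p + q - 1)"
    using eq' assms unfolding a_def[symmetric] b_def[symmetric]
    by (simp add: norm_of_real del: of_real_divide)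
  have "(p - q) / (p + q - 1) - 1 = - ((2 * q - 1) / (p + q - 1))"
    using assms by (simp add: field_simps)
  with eq' have "norm (blaschke_factor (of_real a) (of_real b) - 1) = \<bar>(2 * q - 1) / (p + q - 1)\<bar>"
    by (metis abs_minus_cancel norm_of_real of_real_1 of_real_diff)
  also have "\<dots> = (2 * q - 1) / (p + q - 1)" using assms by simp
  also have "\<dots> \<le> 2 * q / p" using assms by (intro frac_le) auto
  finally show "norm (blaschke_factor (of_real (1 - 1 / p)) (of_real (1 - 1 / q)) - 1) \<le> 2 * q / p"
    by (simp add: a_def b_def)
qed

lemma norm_prodinf_le:
  fixes f :: "nat \<Rightarrow> complex"
  assumes "convergent_prod f" "\<And>n. norm (f n) \<le> 1"
  shows "norm (prodinf f) \<le> norm (f m)"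
proof (rule tendsto_upperbound)
  show "(\<lambda>n. norm (\<Prod>i\<le>n. f i)) \<longlonglongrightarrow> norm (prodinf f)"
    by (intro tendsto_norm convergent_prod_LIMSEQ assms)
  show "\<forall>\<^sub>F n in sequentially. norm (\<Prod>i\<le>n. f i) \<le> norm (f m)"
  proof (rule eventually_sequentiallyI[of m])
    fix n assume "m \<le> n"
    hence "norm (\<Prod>i\<le>n. f i) = norm (f m) * (\<Prod>i\<in>{..n} - {m}. norm (f i))"
      by (simp add: prod_norm prod.remove[of "{..n}" m] norm_mult)
    also have "\<dots> \<le> norm (f m) * 1"
      by (intro mult_left_mono prod_le_1) (auto simp: assms)
    finally show "norm (\<Prod>i\<le>n. f i) \<le> norm (f m)" by simp
  qed
qed simp

text \<open>The product omitting node \<open>2 * n\<close> is bounded by the one factor of its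
  partner \<open>2 * n + 1\<close>, which is at most \<open>1 / (2 * n + 2)\<close>; hence the
  infimum cannot be positive.\<close>

lemma not_Carleson_sequence_if_close_pairs:
  assumes p: "\<And>n. p n > 1" "summable (\<lambda>n. 1 / p n)"
    and pair: "\<And>n. p (2 * n + 1) = (1 + 1 / (2 * real n + 2)) * p (2 * n)"
  shows "\<not> Carleson_sequence (\<lambda>n. of_real (1 - 1 / p n))"
proof
  let ?\<Lambda> = "\<lambda>n. of_real (1 - 1 / p n) :: complex"
  let ?I = "INF k. norm (blaschke_product ?\<Lambda> (- {k}) (?\<Lambda> k))"
  assume "Carleson_sequence ?\<Lambda>"
  hence I: "?I > 0" by (simp add: Carleson_sequence_def)
  have "?I \<le> inverse (real (Suc n))" for n
  proof -
    let ?f = "\<lambda>i. if i \<in> - {2 * n} then blaschke_factor (?\<Lambda> i) (?\<Lambda> (2 * n)) else 1"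
    have "summable (\<lambda>i. 2 * p (2 * n) * (1 / p i))" by (intro summable_mult p)
    hence "summable (\<lambda>i. norm (?f i - 1))"
    proof (rule summable_comparison_test'[where N = 0])
      show "norm (norm (?f i - 1)) \<le> 2 * p (2 * n) * (1 / p i)" for i
        using norm_blaschke_factor_real(2)[OF p(1) p(1), of i "2 * n"] p(1)[of i] p(1)[of "2 * n"] by auto
    qed
    hence "convergent_prod ?f"
      by (intro abs_convergent_prod_imp_convergent_prod summable_imp_abs_convergent_prod)
    moreover have "norm (?f i) \<le> 1" for i
      using norm_blaschke_factor_real(1)[OF p(1) p(1), of i "2 * n"] p(1)[of i] p(1)[of "2 * n"]
      by (auto simp: divide_le_eq)
    ultimately have "norm (prodinf ?f) \<le> norm (?f (2 * n + 1))"
      by (rule norm_prodinf_le)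
    also have "\<dots> = \<bar>p (2 * n + 1) - p (2 * n)\<bar> / (p (2 * n + 1) + p (2 * n) - 1)"
      using norm_blaschke_factor_real(1)[OF p(1) p(1), of "2 * n + 1" "2 * n"] by simp
    also have "\<bar>p (2 * n + 1) - p (2 * n)\<bar> = p (2 * n) / (2 * real n + 2)"
      using p(1)[of "2 * n"] by (subst pair) (simp add: algebra_simps)
    also have "p (2 * n) / (2 * real n + 2) / (p (2 * n + 1) + p (2 * n) - 1) \<le>
        p (2 * n) / (2 * real n + 2) / p (2 * n)"
      using p(1)[of "2 * n"] p(1)[of "2 * n + 1"] by (intro divide_left_mono) auto
    also have "\<dots> \<le> inverse (real (Suc n))"
    proof -
      have "p (2 * n) / (2 * real n + 2) / p (2 * n) = inverse (2 * real n + 2)"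
        using p(1)[of "2 * n"] by (simp add: divide_simps)
      also have "\<dots> \<le> inverse (real (Suc n))"
        by (intro le_imp_inverse_le) auto
      finally show ?thesis .
    qed
    finally have "norm (blaschke_product ?\<Lambda> (- {2 * n}) (?\<Lambda> (2 * n))) \<le> inverse (real (Suc n))"
      unfolding blaschke_product_def .
    moreover have "?I \<le> norm (blaschke_product ?\<Lambda> (- {2 * n}) (?\<Lambda> (2 * n)))"
      by (intro cINF_lower bdd_belowI2[of _ 0]) auto
    ultimately show ?thesis by linarith
  qed
  with I show False
    using reals_Archimedean[OF I] by (meson not_less)
qed

section \<open>Recursive choice of the nodes and growth of the series\<close>

text \<open>\<open>K\<close> is a free lower bound for the scale of each pair. The summand 4
  separates consecutive pairs; the other summand lets the scale of pair \<open>Suc n\<close> absorb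
  \<open>2 ^ j * newton_bound j\<close> for both its indices \<open>j\<close>.\<close>

primrec node_scale :: "(nat \<Rightarrow> real) \<Rightarrow> nat \<Rightarrow> real" where
  "node_scale K 0 = max 2 (K 0)"
| "node_scale K (Suc n) = max (K (Suc n))
     ((4 + 2 ^ (2 * n + 3) * (newton_bound (2 * n + 2) + newton_bound (2 * n + 3))) * node_scale K n)"

text \<open>The odd partner is stretched by exactly the least ratio that the Newton estimates allow;
  this ratio tends to 1, so the pairs close up.\<close>

definition paired_nodes :: "(nat \<Rightarrow> real) \<Rightarrow> nat \<Rightarrow> real" where
  "paired_nodes K j = (if even j then 1 else 1 + 1 / (real j + 1)) * node_scale K (j div 2)"

lemma node_scale_ge: "node_scale K n \<ge> K n"
  by (cases n) auto

lemma node_scale_ge_2: "node_scale K n \<ge> 2"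
  and node_scale_Suc_ge: "node_scale K (Suc n) \<ge> 4 * node_scale K n"
proof -
  have step: "node_scale K (Suc n) \<ge> 4 * node_scale K n" if "node_scale K n \<ge> 2" for n
  proof -
    have "4 * node_scale K n \<le>
        (4 + 2 ^ (2 * n + 3) * (newton_bound (2 * n + 2) + newton_bound (2 * n + 3))) * node_scale K n"
      using that newton_bound_ge_1[of "2 * n + 2"] newton_bound_ge_1[of "2 * n + 3"]
      by (intro mult_right_mono) auto
    thus ?thesis by simp
  qed
  show ge: "node_scale K n \<ge> 2" for n
  proof (induction n)
    case (Suc n)
    show ?case using step[OF Suc.IH] Suc.IH by linarith
  qed simp
  show "node_scale K (Suc n) \<ge> 4 * node_scale K n" by (rule step[OF ge])
qed

lemma mono_node_scale: "mono (node_scale K)"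
  unfolding mono_iff_le_Suc
proof
  show "node_scale K n \<le> node_scale K (Suc n)" for n
    using node_scale_ge_2[of K n] node_scale_Suc_ge[of K n] by linarith
qed

lemma paired_nodes_even: "paired_nodes K (2 * n) = node_scale K n"
  by (simp add: paired_nodes_def)

lemma paired_nodes_bounds:
  shows "paired_nodes K j \<ge> node_scale K (j div 2)"
    and "paired_nodes K j \<le> 2 * node_scale K (j div 2)"
proof -
  define t :: real where "t = (if even j then 1 else 1 + 1 / (real j + 1))"
  have "1 * node_scale K (j div 2) \<le> t * node_scale K (j div 2)"
    "t * node_scale K (j div 2) \<le> 2 * node_scale K (j div 2)"
    using node_scale_ge_2[of K "j div 2"] by (auto simp: t_def intro!: mult_right_mono)
  thus "paired_nodes K j \<ge> node_scale K (j div 2)"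
    and "paired_nodes K j \<le> 2 * node_scale K (j div 2)"
    by (auto simp: paired_nodes_def t_def)
qed

lemma paired_nodes_gt_1: "paired_nodes K j > 1"
  using paired_nodes_bounds(1)[of K j] node_scale_ge_2[of K "j div 2"] by linarith

text \<open>Equality within a pair; across pairs both the ratio and the stretching are at most 2,
  and scales grow at least fourfold.\<close>

lemma paired_nodes_ratio:
  assumes "k < j"
  shows "(1 + 1 / (real j + 1)) * paired_nodes K k \<le> paired_nodes K j"
proof (cases "k div 2 = j div 2")
  case True
  hence "even k" "odd j" using assms by presburger+
  thus ?thesis using True by (simp add: paired_nodes_def)
next
  case False
  hence less: "Suc (k div 2) \<le> j div 2" using assms by presburger
  have "(1 + 1 / (real j + 1)) * paired_nodes K k \<le> 2 * (2 * node_scale K (k div 2))"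
    using paired_nodes_bounds(2)[of K k] paired_nodes_gt_1[of K k] by (intro mult_mono) auto
  also have "\<dots> \<le> node_scale K (Suc (k div 2))" using node_scale_Suc_ge[of K "k div 2"] by simp
  also have "\<dots> \<le> node_scale K (j div 2)" by (rule monoD[OF mono_node_scale less])
  also have "\<dots> \<le> paired_nodes K j" by (rule paired_nodes_bounds)
  finally show ?thesis .
qed

lemma paired_nodes_growth:
  assumes "2 * n + 2 \<le> j"
  shows "newton_bound j * paired_nodes K (2 * n) \<le> (1 / 2) ^ j * paired_nodes K j"
proof -
  \<comment> \<open>The pair just before the one containing \<open>j\<close>; monotonicity of the
    scales reduces any earlier \<open>n\<close> to it.\<close>
  define m where "m = j div 2 - 1"
  have m: "j div 2 = Suc m" "n \<le> m" "j = 2 * m + 2 \<or> j = 2 * m + 3"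
    using assms unfolding m_def by presburger+
  note ge = newton_bound_ge_1[of "2 * m + 2"] newton_bound_ge_1[of "2 * m + 3"]
  have "newton_bound j * paired_nodes K (2 * n) \<le> newton_bound j * node_scale K m"
    using monoD[OF mono_node_scale m(2)] newton_bound_ge_1[of j]
    by (intro mult_left_mono) (auto simp: paired_nodes_even)
  hence "2 ^ j * (newton_bound j * paired_nodes K (2 * n)) \<le> 2 ^ j * (newton_bound j * node_scale K m)"
    by simp
  also have "\<dots> = (2 ^ j * newton_bound j) * node_scale K m" by simp
  also have "\<dots> \<le> (4 + 2 ^ (2 * m + 3) * (newton_bound (2 * m + 2) + newton_bound (2 * m + 3))) *
      node_scale K m"
  proof (rule mult_right_mono)
    have "2 ^ j * newton_bound j \<le>
        2 ^ (2 * m + 3) * (newton_bound (2 * m + 2) + newton_bound (2 * m + 3))"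
      using m(3) ge by (intro mult_mono power_increasing) auto
    thus "2 ^ j * newton_bound j \<le>
        4 + 2 ^ (2 * m + 3) * (newton_bound (2 * m + 2) + newton_bound (2 * m + 3))" by simp
  qed (use node_scale_ge_2[of K m] in simp)
  also have "\<dots> \<le> node_scale K (Suc m)" by simp
  also have "\<dots> \<le> paired_nodes K j" using paired_nodes_bounds(1)[of K j] m(1) by simp
  finally show ?thesis by (simp add: power_one_over field_simps)
qed

lemma summable_newton_bound_nodes: "summable (\<lambda>j. newton_bound j / paired_nodes K j)"
proof (rule summable_comparison_test'[where N = 2])
  show "summable (\<lambda>j. (1 / 2 :: real) ^ j)" by (intro summable_geometric) simp
  fix j :: nat assume j: "j \<ge> 2"
  have "newton_bound j * 1 \<le> newton_bound j * paired_nodes K 0"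
    using paired_nodes_gt_1[of K 0] newton_bound_ge_1[of j] by (intro mult_left_mono) auto
  also have "\<dots> \<le> (1 / 2) ^ j * paired_nodes K j"
    using paired_nodes_growth[of 0 j K] j by simp
  finally have "newton_bound j / paired_nodes K j \<le> (1 / 2) ^ j"
    using paired_nodes_gt_1[of K j] by (simp add: divide_le_eq)
  thus "norm (newton_bound j / paired_nodes K j) \<le> (1 / 2) ^ j"
    using paired_nodes_gt_1[of K j] newton_bound_ge_1[of j] by simp
qed

text \<open>Terms up to pair \<open>n\<close> use that the basis is bounded by 1. Later ones decay
  like \<open>paired_nodes K (2 * n) / paired_nodes K j\<close> and are dominated by a geometric
  series of sum 2. The bound does not involve \<open>K\<close>.\<close>

lemma norm_newton_series_le:
  assumes c: "\<And>j. norm (c j) \<le> 1"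
    and z: "Re z \<le> 1" "1 / paired_nodes K (2 * n) \<le> norm (1 - z)"
  shows "norm (newton_series (paired_nodes K) c z) \<le> (\<Sum>j<2 * n + 2. newton_bound j) + 2"
proof -
  let ?p = "paired_nodes K"
  have pos: "?p k > 0" for k using paired_nodes_gt_1[of K k] by simp
  let ?g = "\<lambda>j. if j \<in> {..<2 * n + 2} then newton_bound j else 0"
  have coeff: "norm (newton_coeff ?p c j) \<le> newton_bound j" for j
    by (rule norm_newton_coeff_le[OF pos paired_nodes_ratio c])
  have "0 < 1 / ?p (2 * n)" using pos by simp
  hence "norm (1 - z) > 0" using z(2) by linarith
  hence z1: "z \<noteq> 1" by auto
  have sums: "(\<lambda>j. ?g j + (1 / 2) ^ j) sums ((\<Sum>j<2 * n + 2. newton_bound j) + 1 / (1 - 1 / 2))"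
    by (intro sums_add sums_If_finite_set geometric_sums) auto
  have "norm (newton_coeff ?p c j * newton_basis ?p j z) \<le> ?g j + (1 / 2) ^ j" for j
  proof (cases "j < 2 * n + 2")
    case True
    have "norm (newton_coeff ?p c j) * norm (newton_basis ?p j z) \<le> newton_bound j * 1"
      using coeff[of j] norm_newton_basis_le(1)[OF pos z(1)] newton_bound_ge_1[of j]
      by (intro mult_mono) auto
    also have "\<dots> \<le> ?g j + (1 / 2) ^ j" using True by simp
    finally show ?thesis by (simp add: norm_mult)
  next
    case False
    have "norm (newton_basis ?p j z) \<le> 1 / (?p j * norm (1 - z))"
      by (rule norm_newton_basis_le(2)[OF pos z(1) z1])
    also have "\<dots> \<le> 1 / (?p j * (1 / ?p (2 * n)))"
      using pos[of j] pos[of "2 * n"] z(2) \<open>norm (1 - z) > 0\<close>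
      by (intro divide_left_mono mult_left_mono mult_pos_pos) auto
    also have "\<dots> = ?p (2 * n) / ?p j" by simp
    finally have "norm (newton_coeff ?p c j) * norm (newton_basis ?p j z) \<le>
        newton_bound j * (?p (2 * n) / ?p j)"
      using coeff[of j] newton_bound_ge_1[of j] by (intro mult_mono) auto
    also have "\<dots> \<le> (1 / 2) ^ j"
      using paired_nodes_growth[of n j K] False pos[of j] by (simp add: divide_le_eq)
    finally show ?thesis using False by (simp add: norm_mult)
  qed
  hence "norm (newton_series ?p c z) \<le> (\<Sum>j. ?g j + (1 / 2) ^ j)"
    unfolding newton_series_def by (rule norm_suminf_le) (rule sums_summable[OF sums])
  also have "\<dots> = (\<Sum>j<2 * n + 2. newton_bound j) + 2"
    using sums_unique[OF sums] by simp
  finally show ?thesis .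
qed

section \<open>Construction of the sequence and free interpolation\<close>

lemma obtain_interpolating_close_pairs:
  fixes \<Psi> :: "real \<Rightarrow> real"
  assumes nonneg: "\<And>x. x \<ge> 0 \<Longrightarrow> \<Psi> x \<ge> 0" and mono: "mono_on {0..} \<Psi>"
  obtains \<Lambda> where "disk_sequence \<Lambda>" "\<not> Carleson_sequence \<Lambda>"
    and "\<forall>c. (\<forall>n. norm (c n) \<le> 1) \<longrightarrow> (\<exists>h\<in>Hardy_Orlicz \<Psi>. \<forall>n. h (\<Lambda> n) = c n)"
proof -
  \<comment> \<open>These growth levels are fixed before any node, so the scales can be adapted to
    them without circularity.\<close>
  define M where "M n = (\<Sum>j<2 * n + 2. newton_bound j) + 2" for n
  define L where "L n = \<Psi> (M (Suc n)) + M (Suc n)" for n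
  have M: "M n \<ge> 2" for n
    using newton_bound_ge_1 unfolding M_def by (simp add: sum_nonneg order_trans[of 0 1])
  have L: "L n > 0" for n
    using M[of "Suc n"] nonneg[of "M (Suc n)"] by (simp add: L_def)
  have "\<exists>k. \<forall>R\<ge>k. measure circle_measure (cball 1 (2 / R)) \<le> (1 / 2) ^ n / L n" for n
    using circle_measure_cball_small[of "(1 / 2) ^ n / L n"] L[of n] by auto
  then obtain k where k: "\<And>n R. R \<ge> k n \<Longrightarrow>
      measure circle_measure (cball 1 (2 / R)) \<le> (1 / 2) ^ n / L n"
    by metis
  \<comment> \<open>\<open>real n\<close> drives the nodes to 1; \<open>k n\<close> makes the ball
    of radius \<open>2 / p (2 * n)\<close> so small that its measure times \<open>L n\<close> is at
    most \<open>(1 / 2) ^ n\<close>.\<close>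
  define K where "K n = max (real n) (k n)" for n
  define p where "p = paired_nodes K"
  define \<Lambda> where "\<Lambda> n = (of_real (1 - 1 / p n) :: complex)" for n
  have gt_1: "p n > 1" for n by (simp add: p_def paired_nodes_gt_1)
  have pos: "p n > 0" for n using gt_1[of n] by simp
  have ratio: "(1 + 1 / (real j + 1)) * p i \<le> p j" if "i < j" for i j
    unfolding p_def using that by (rule paired_nodes_ratio)
  have p_ge: "p (2 * n) \<ge> K n" for n
    by (simp add: p_def paired_nodes_even node_scale_ge)
  have disk: "disk_sequence \<Lambda>"
    unfolding disk_sequence_def
  proof
    have "strict_mono p"
    proof (rule strict_monoI)
      fix i j :: nat assume "i < j"
      have "p i < (1 + 1 / (real j + 1)) * p i" using pos[of i] by (simp add: algebra_simps)
      with ratio[OF \<open>i < j\<close>] show "p i < p j" by linarith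
    qed
    hence "inj p" by (rule strict_mono_imp_inj_on)
    show "inj \<Lambda>"
    proof (rule injI)
      fix i j assume "\<Lambda> i = \<Lambda> j"
      hence "p i = p j" unfolding \<Lambda>_def of_real_eq_iff by simp
      with \<open>inj p\<close> show "i = j" by (rule injD)
    qed
    have "norm (\<Lambda> n) < 1" for n
      using gt_1[of n] unfolding \<Lambda>_def norm_of_real by (simp add: abs_if)
    thus "range \<Lambda> \<subseteq> unit_disk" by auto
  qed
  have sum_bound: "summable (\<lambda>j. newton_bound j / p j)"
    unfolding p_def by (rule summable_newton_bound_nodes)
  have "\<not> Carleson_sequence \<Lambda>"
    unfolding \<Lambda>_def[abs_def]
  proof (rule not_Carleson_sequence_if_close_pairs[OF gt_1])
    show "summable (\<lambda>n. 1 / p n)"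
    proof (rule summable_comparison_test'[OF sum_bound])
      show "norm (1 / p n) \<le> newton_bound n / p n" for n
        using newton_bound_ge_1[of n] pos[of n] by (simp add: divide_right_mono)
    qed
    show "p (2 * n + 1) = (1 + 1 / (2 * real n + 2)) * p (2 * n)" for n
      by (simp add: p_def paired_nodes_def)
  qed
  moreover have "\<exists>h\<in>Hardy_Orlicz \<Psi>. \<forall>n. h (\<Lambda> n) = c n" if c: "\<And>n. norm (c n) \<le> 1" for c
  proof (intro bexI allI)
    show "newton_series p c (\<Lambda> n) = c n" for n
      unfolding \<Lambda>_def by (rule newton_series_interpolates[of p, OF pos ratio])
    have "summable (\<lambda>j. norm (newton_coeff p c j) / p j)"
    proof (rule summable_comparison_test'[OF sum_bound])
      show "norm (norm (newton_coeff p c j) / p j) \<le> newton_bound j / p j" for j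
        using norm_newton_coeff_le[of p c j, OF pos ratio c] pos[of j]
        by (auto intro!: divide_right_mono)
    qed
    note series = newton_series_holomorphic[of p c, OF pos this] newton_series_continuous[of p c, OF pos this]
    show "newton_series p c \<in> Hardy_Orlicz \<Psi>"
    proof (rule Hardy_Orlicz_if_staircase_bound[where R = "\<lambda>n. p (2 * n)" and M = M])
      show "filterlim (\<lambda>n. p (2 * n)) at_top sequentially"
      proof (rule filterlim_at_top_mono[OF filterlim_real_sequentially])
        show "\<forall>\<^sub>F n in sequentially. real n \<le> p (2 * n)"
          using p_ge by (intro always_eventually allI) (auto simp: K_def)
      qed
      show "norm (newton_series p c z) \<le> M n"
        if "z \<in> cball 0 1" "1 / p (2 * n) \<le> norm (1 - z)" for n z
      proof -
        have "Re z \<le> 1" using that(1) complex_Re_le_cmod[of z] by simp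
        thus ?thesis
          using norm_newton_series_le[OF c, of z K n] that(2) by (simp add: M_def p_def)
      qed
      show "summable (\<lambda>n. measure circle_measure (cball 1 (2 / p (2 * n))) *
          (\<Psi> (M (Suc n)) + M (Suc n)))"
      proof (rule summable_comparison_test')
        show "summable (\<lambda>n. (1 / 2 :: real) ^ n)" by (intro summable_geometric) simp
        fix n
        have "measure circle_measure (cball 1 (2 / p (2 * n))) \<le> (1 / 2) ^ n / L n"
          using p_ge[of n] by (intro k) (simp add: K_def)
        hence "measure circle_measure (cball 1 (2 / p (2 * n))) * L n \<le> (1 / 2) ^ n"
          using L[of n] by (simp add: le_divide_eq)
        thus "norm (measure circle_measure (cball 1 (2 / p (2 * n))) *
            (\<Psi> (M (Suc n)) + M (Suc n))) \<le> (1 / 2) ^ n"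
          using L[of n] by (simp add: L_def)
      qed
      show "M n \<ge> 0" for n using M[of n] by simp
    qed (use series nonneg mono pos in auto)
  qed
  ultimately show ?thesis using disk by (intro that[of \<Lambda>]) simp_all
qed

theorem corollary6p9:
  fixes \<phi> \<Psi> :: "real \<Rightarrow> real"
  assumes "strongly_convex \<phi>"
    and "\<And>x. x \<ge> 0 \<Longrightarrow> \<Psi> x \<ge> 0"
    and "strict_mono_on {0..} \<Psi>"
    and "convex_on {0..} \<Psi>"
    and "\<not> bdd_above (\<Psi> ` {0..})"
    and "Hardy_Orlicz \<Psi> \<subseteq> Mult (Hardy_Orlicz (comp_log \<phi>))"
  shows "\<exists>\<Lambda>. disk_sequence \<Lambda> \<and> \<not> Carleson_sequence \<Lambda> \<and>
    free_interpolating (Hardy_Orlicz (comp_log \<phi>)) \<Lambda>"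
proof -
  let ?X = "Hardy_Orlicz (comp_log \<phi>)"
  have "mono_on {0..} \<Psi>"
    using assms(3) by (rule strict_mono_on_imp_mono_on)
  with assms(2) obtain \<Lambda> where \<Lambda>: "disk_sequence \<Lambda>" "\<not> Carleson_sequence \<Lambda>"
    and ex: "\<forall>c. (\<forall>n. norm (c n) \<le> 1) \<longrightarrow> (\<exists>h\<in>Hardy_Orlicz \<Psi>. \<forall>n. h (\<Lambda> n) = c n)"
    by (rule obtain_interpolating_close_pairs)
  have "\<exists>g\<in>?X. \<forall>n. g (\<Lambda> n) = b n"
    if f: "f \<in> ?X" and b: "\<And>n. norm (b n) \<le> norm (f (\<Lambda> n))" for f and b :: "nat \<Rightarrow> complex"
  proof -
    \<comment> \<open>Where \<open>f\<close> vanishes at a node, division by zero gives 0, and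
      \<open>b n\<close> is 0 there too, so the product \<open>h * f\<close> still has the right
      value.\<close>
    have "norm (b n / f (\<Lambda> n)) \<le> 1" for n
      using b[of n] by (cases "f (\<Lambda> n) = 0") (auto simp: norm_divide divide_le_eq)
    with ex[rule_format, of "\<lambda>n. b n / f (\<Lambda> n)"]
    obtain h where h: "h \<in> Hardy_Orlicz \<Psi>" "\<And>n. h (\<Lambda> n) = b n / f (\<Lambda> n)"
      by blast
    have "(\<lambda>z. h z * f z) \<in> ?X" using assms(6) h(1) f by (auto simp: Mult_def)
    moreover have "h (\<Lambda> n) * f (\<Lambda> n) = b n" for n
      using h(2)[of n] b[of n] by (cases "f (\<Lambda> n) = 0") auto
    ultimately show ?thesis by (intro bexI[of _ "\<lambda>z. h z * f z"]) auto
  qed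
  hence "free_interpolating ?X \<Lambda>"
    using \<Lambda>(1) by (simp add: free_interpolating_def)
  with \<Lambda> show ?thesis by (intro exI[of _ \<Lambda>]) simp
qed

end
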